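(* There are fixed finite sets $\mathcal{T}$ and $\mathcal{X}$ such that the following holds for the problem: given a run $\sigma\in\Sigma^*$ and a pair of (marked) events $e,f$ in it, decide whether there is a run $\rho$ with $\sigma\rightsquigarrow_s^*\rho$ in which the relative order of $e$ and $f$ is flipped compared to $\sigma$. Any one-pass streaming algorithm for this problem requires space linear in $n=|\sigma|$ in the worst case. Further, the time $T(n)$ and space $S(n)$ used by any multi-pass streaming algorithm for this problem must satisfy $S(n)\cdot T(n)\in\Omega(n^2)$.
   Context: Given finite sets $\mathcal{T}$ (threads) and $\mathcal{X}$ (memory locations), let $\Sigma=\{\langle t,op(x)\rangle : t\in\mathcal{T},\ op\in\{\mathtt{w},\mathtt{r}\},\ x\in\mathcal{X}\}$ ($\mathtt{w}$ = write, $\mathtt{r}$ = read). A run is a finite word $\sigma\in\Sigma^*$; the occurrences of letters in it are its events. The reads-from map $\mathsf{rf}_\sigma$ is the partial map sending each read event on a location $x$ to the last write event on $x$ preceding it in $\sigma$, undefined if there is no such write. Reads-from equivalence: $\sigma\equiv_{\mathsf{rf}}\rho$ iff for every thread $t$ the subsequence of events of thread $t$ is the same in $\sigma$ and $\rho$ (same events and same program order; so the $j$-th event of thread $t$ in $\sigma$ is identified with the $j$-th event of thread $t$ in $\rho$), and, under this identification, $\mathsf{rf}_\sigma=\mathsf{rf}_\rho$. Sliced reordering: $\sigma\rightsquigarrow_s\rho$ iff $\sigma\equiv_{\mathsf{rf}}\rho$ and the events of $\sigma$ can be partitioned into two disjoint (possibly empty) subsequences $\sigma_1,\sigma_2$ of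 $\sigma$ such that $\rho=\sigma_1\cdot\sigma_2$ as sequences of events (identifying, for every thread $t$ and every $j$, the $j$-th event of thread $t$ in $\sigma$ with the $j$-th event of thread $t$ in $\rho$). $\rightsquigarrow_s^*$ is the reflexive transitive closure of $\rightsquigarrow_s$. Algorithms are deterministic and access the input sequentially: a one-pass algorithm reads the input once from left to right; a multi-pass algorithm may make several sequential passes over the (read-only) input. Space is working memory in bits; time is total running time over all passes. *)

theory Defs
  imports Complex_Main "HOL-Library.Landau_Symbols"
begin

section \<open>Runs and reads-from equivalence\<close>

datatype access = Read | Write

datatype ('t, 'x) letter = Letter (thread: 't) (access: access) (loc: 'x)

type_synonym ('t, 'x) run = "('t, 'x) letter list"

definition alphabet :: "'t set \<Rightarrow> 'x set \<Rightarrow> ('t, 'x) letter set" where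
  "alphabet T X = {a. thread a \<in> T \<and> loc a \<in> X}"

text \<open>
  An event is named by its thread \<open>t\<close> and its (0-based) index \<open>j\<close> among the events of \<open>t\<close>.
  Using these names across runs is the identification of the \<open>j\<close>-th event of \<open>t\<close> in one run with
  the \<open>j\<close>-th event of \<open>t\<close> in another.
\<close>
type_synonym 't event = "'t \<times> nat"

definition event_at :: "('t, 'x) run \<Rightarrow> nat \<Rightarrow> 't event" where
  "event_at \<sigma> i =
    (thread (\<sigma> ! i), length (filter (\<lambda>a. thread a = thread (\<sigma> ! i)) (take i \<sigma>)))"

definition events :: "('t, 'x) run \<Rightarrow> 't event list" where
  "events \<sigma> = map (event_at \<sigma>) [0..<length \<sigma>]"

definition last_write_before :: "('t, 'x) run \<Rightarrow> nat \<Rightarrow> nat \<Rightarrow> bool" where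
  "last_write_before \<sigma> i k \<longleftrightarrow>
    k < i \<and> access (\<sigma> ! k) = Write \<and> loc (\<sigma> ! k) = loc (\<sigma> ! i) \<and>
    (\<forall>l. k < l \<and> l < i \<longrightarrow> \<not> (access (\<sigma> ! l) = Write \<and> loc (\<sigma> ! l) = loc (\<sigma> ! i)))"

text \<open>The partial map reads-from, represented by its graph.\<close>
definition rf :: "('t, 'x) run \<Rightarrow> ('t event \<times> 't event) set" where
  "rf \<sigma> = {(event_at \<sigma> i, event_at \<sigma> k) | i k.
     i < length \<sigma> \<and> access (\<sigma> ! i) = Read \<and> last_write_before \<sigma> i k}"

definition rf_equiv :: "('t, 'x) run \<Rightarrow> ('t, 'x) run \<Rightarrow> bool" where
  "rf_equiv \<sigma> \<rho> \<longleftrightarrow>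
    (\<forall>t. filter (\<lambda>a. thread a = t) \<sigma> = filter (\<lambda>a. thread a = t) \<rho>) \<and> rf \<sigma> = rf \<rho>"

section \<open>Sliced reorderings\<close>

definition sliced :: "('t, 'x) run \<Rightarrow> ('t, 'x) run \<Rightarrow> bool" where
  "sliced \<sigma> \<rho> \<longleftrightarrow>
    rf_equiv \<sigma> \<rho> \<and> (\<exists>I. events \<rho> = nths (events \<sigma>) I @ nths (events \<sigma>) (- I))"

definition before :: "('t, 'x) run \<Rightarrow> 't event \<Rightarrow> 't event \<Rightarrow> bool" where
  "before \<sigma> e f \<longleftrightarrow> (\<exists>i j. i < j \<and> j < length \<sigma> \<and> event_at \<sigma> i = e \<and> event_at \<sigma> j = f)"

definition flippable :: "('t, 'x) run \<Rightarrow> 't event \<Rightarrow> 't event \<Rightarrow> bool" where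
  "flippable \<sigma> e f \<longleftrightarrow>
    (\<exists>\<rho>. sliced\<^sup>*\<^sup>* \<sigma> \<rho> \<and> (before \<sigma> e f \<and> before \<rho> f e \<or> before \<sigma> f e \<and> before \<rho> e f))"

section \<open>Deterministic streaming algorithms\<close>

text \<open>
  The memory, a bit string, is everything the algorithm carries from one step to the next (a
  finite control is to be stored in it as well); the position of the reading head belongs to the
  read-only input device and is not charged. A step sees the memory and the symbol under the head,
  or \<open>None\<close> at the end of the input. It replaces the memory and then moves the head one symbol
  to the right (\<open>Advance\<close>), leaves it in place (\<open>Stay\<close>), starts a new pass from the first symbol
  (\<open>Rewind\<close>), or stops with an answer. Every step costs one unit of time. The step function is
  arbitrary, so the model is at least as powerful as any concrete one in which each operation takes
  at least unit time, and lower bounds carry over.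
\<close>
datatype action = Advance | Stay | Rewind | Halt bool

record 'a algorithm =
  initial :: "bool list"
  step :: "bool list \<Rightarrow> 'a option \<Rightarrow> bool list \<times> action"

datatype config = Running (memory: "bool list") (head: nat) | Halted (memory: "bool list") bool

definition symbol_at :: "'a list \<Rightarrow> nat \<Rightarrow> 'a option" where
  "symbol_at w h = (if h < length w then Some (w ! h) else None)"

fun next_config :: "'a algorithm \<Rightarrow> 'a list \<Rightarrow> config \<Rightarrow> config" where
  "next_config A w (Running m h) =
    (case step A m (symbol_at w h) of
      (m', Advance) \<Rightarrow> Running m' (min (Suc h) (length w))
    | (m', Stay) \<Rightarrow> Running m' h
    | (m', Rewind) \<Rightarrow> Running m' 0
    | (m', Halt b) \<Rightarrow> Halted m' b)"
| "next_config A w (Halted m b) = Halted m b"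

definition config_after :: "'a algorithm \<Rightarrow> 'a list \<Rightarrow> nat \<Rightarrow> config" where
  "config_after A w k = (next_config A w ^^ k) (Running (initial A) 0)"

section \<open>The decision problem and its resources\<close>

text \<open>Each letter is accompanied by two flags, telling whether it is \<open>e\<close> and whether it is \<open>f\<close>.\<close>
type_synonym ('t, 'x) marked_letter = "('t, 'x) letter \<times> bool \<times> bool"

definition marked :: "('t, 'x) run \<Rightarrow> nat \<Rightarrow> nat \<Rightarrow> ('t, 'x) marked_letter list" where
  "marked \<sigma> i j = map (\<lambda>k. (\<sigma> ! k, k = i, k = j)) [0..<length \<sigma>]"

definition instances :: "'t set \<Rightarrow> 'x set \<Rightarrow> (('t, 'x) run \<times> nat \<times> nat) set" where
  "instances T X =
    {(\<sigma>, i, j). \<sigma> \<in> lists (alphabet T X) \<and> i < length \<sigma> \<and> j < length \<sigma> \<and> i \<noteq> j}"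

definition decides_flip ::
  "'t set \<Rightarrow> 'x set \<Rightarrow> ('t, 'x) marked_letter algorithm \<Rightarrow> bool" where
  "decides_flip T X A \<longleftrightarrow>
    (\<forall>(\<sigma>, i, j) \<in> instances T X. \<exists>k m.
      config_after A (marked \<sigma> i j) k = Halted m (flippable \<sigma> (event_at \<sigma> i) (event_at \<sigma> j)))"

definition one_pass ::
  "'t set \<Rightarrow> 'x set \<Rightarrow> ('t, 'x) marked_letter algorithm \<Rightarrow> bool" where
  "one_pass T X A \<longleftrightarrow>
    (\<forall>(\<sigma>, i, j) \<in> instances T X. \<forall>k m h.
      config_after A (marked \<sigma> i j) k = Running m h \<longrightarrow>
      snd (step A m (symbol_at (marked \<sigma> i j) h)) \<noteq> Rewind)"

text \<open>\<open>S n\<close> and \<open>\<tau> n\<close> bound the space and time on all instances whose run has length \<open>n\<close>.\<close>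
definition uses_space ::
  "'t set \<Rightarrow> 'x set \<Rightarrow> ('t, 'x) marked_letter algorithm \<Rightarrow> (nat \<Rightarrow> nat) \<Rightarrow> bool" where
  "uses_space T X A S \<longleftrightarrow>
    (\<forall>(\<sigma>, i, j) \<in> instances T X. \<forall>k.
      length (memory (config_after A (marked \<sigma> i j) k)) \<le> S (length \<sigma>))"

definition uses_time ::
  "'t set \<Rightarrow> 'x set \<Rightarrow> ('t, 'x) marked_letter algorithm \<Rightarrow> (nat \<Rightarrow> nat) \<Rightarrow> bool" where
  "uses_time T X A \<tau> \<longleftrightarrow>
    (\<forall>(\<sigma>, i, j) \<in> instances T X. \<exists>k \<le> \<tau> (length \<sigma>). \<exists>m b.
      config_after A (marked \<sigma> i j) k = Halted m b)"

end

theory Submission imports Defs begin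

text \<open>
  Two bit strings \<open>a\<close>, \<open>b\<close> of length \<open>m\<close> are encoded as a run whose first half is executed by thread 0
  and whose second half by thread 1. Thread 1 walks through \<open>m\<close> critical sections (a write and the
  read that observes it) hand over hand: section \<open>j\<close> is on a location determined by \<open>b\<^sub>j\<close> and the
  parity of \<open>j\<close>, and section \<open>j + 1\<close> opens before section \<open>j\<close> closes. Thread 0 performs \<open>m\<close> unobserved
  writes, the \<open>j\<close>-th one to the location determined by \<open>a\<^sub>j\<close>, and such a write cannot fall into a
  section on its location. Once section \<open>0\<close> opens before write \<open>0\<close>, it must also close before it;
  so section \<open>1\<close> opens before write \<open>1\<close>, and so on as long as the bits agree. A final write of
  thread 0 observed by thread 1 inside the last section makes this impossible if \<open>a = b\<close>. If
  \<open>a\<^sub>i \<noteq> b\<^sub>i\<close>, thread 0 overtakes inside section \<open>i\<close>, and postponing the writes of thread 0 one at a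
  time, the last one first, reaches such a schedule by sliced reorderings. Hence the first events of
  the two threads can be flipped iff \<open>a \<noteq> b\<close>, and the pairs \<open>(a, a)\<close> form a fooling set.

  The memory contents at the moments when the head moves between the two halves therefore have to
  distinguish \<open>2\<^sup>m\<close> instances. With \<open>q\<close> such moments and space \<open>S\<close> this gives \<open>m \<le> (S + 1) q\<close>; a single
  pass has \<open>q \<le> 1\<close>, and in general \<open>q\<close> is at most twice the running time over the length of the
  first half, because the head has to walk there from the left end each time.
\<close>

section \<open>Events and reads-from\<close>

abbreviation tcount :: "'t \<Rightarrow> ('t, 'x) run \<Rightarrow> nat" where
  "tcount t w \<equiv> length (filter (\<lambda>a. thread a = t) w)"

lemma event_at_append_left: "i < length u \<Longrightarrow> event_at (u @ w) i = event_at u i"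
  by (simp add: event_at_def nth_append)

lemma event_at_append_right:
  "event_at (u @ w) (length u + i) =
    (thread (w ! i), tcount (thread (w ! i)) u + tcount (thread (w ! i)) (take i w))"
  by (simp add: event_at_def)

lemma tcount_take_mono: "i \<le> j \<Longrightarrow> tcount t (take i w) \<le> tcount t (take j w)"
  by (metis (no_types, lifting) filter_append le_add1 length_append min.absorb1 take_take
      append_take_drop_id)

lemma tcount_take_less:
  assumes "i < j" "i < length w"
  shows "tcount (thread (w ! i)) (take i w) < tcount (thread (w ! i)) (take j w)"
proof -
  have "tcount (thread (w ! i)) (take (Suc i) w) \<le> tcount (thread (w ! i)) (take j w)"
    using assms by (intro tcount_take_mono) simp
  then show ?thesis using assms by (simp add: take_Suc_conv_app_nth)
qed

lemma event_at_less:
  assumes "event_at w i = (t, k)" "event_at w j = (t, l)" "k < l"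
  shows "i < j"
proof (rule ccontr)
  assume "\<not> i < j"
  then have "tcount t (take j w) \<le> tcount t (take i w)" by (intro tcount_take_mono) simp
  with assms show False by (auto simp: event_at_def)
qed

lemma event_at_inj:
  assumes "event_at w i = event_at w j" "i < length w" "j < length w"
  shows "i = j"
proof (rule ccontr)
  assume "i \<noteq> j"
  then consider "i < j" | "j < i" by linarith
  then show False
    using assms tcount_take_less[of i j w] tcount_take_less[of j i w]
    by cases (auto simp: event_at_def)
qed

lemma event_at_exists:
  "k < tcount t w \<Longrightarrow>
    \<exists>i < length w. event_at w i = (t, k) \<and> w ! i = filter (\<lambda>a. thread a = t) w ! k"
proof (induction w rule: rev_induct)
  case (snoc a w)
  show ?case
  proof (cases "k < tcount t w")
    case True
    then obtain i where "i < length w" "event_at w i = (t, k)"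
      "w ! i = filter (\<lambda>a. thread a = t) w ! k" using snoc.IH by blast
    with True show ?thesis
      by (intro exI[of _ i]) (simp add: event_at_append_left nth_append)
  next
    case False
    with snoc.prems have "thread a = t" "k = tcount t w" by (auto split: if_splits)
    then show ?thesis by (intro exI[of _ "length w"]) (simp add: event_at_def)
  qed
qed simp

text \<open>A set with at most one element: the write that a read of \<open>x\<close> appended to
  \<open>w\<close> would observe. If there is no such write, the set is empty and
  \<open>rf_snoc\<close> adds no pair.\<close>

definition last_writes :: "('t, 'x) run \<Rightarrow> 'x \<Rightarrow> 't event set" where
  "last_writes w x = {event_at w k | k.
    k < length w \<and> access (w ! k) = Write \<and> loc (w ! k) = x \<and>
    (\<forall>l. k < l \<and> l < length w \<longrightarrow> \<not> (access (w ! l) = Write \<and> loc (w ! l) = x))}"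

lemma last_writes_snoc:
  "last_writes (w @ [a]) x =
    (if access a = Write \<and> loc a = x then {(thread a, tcount (thread a) w)} else last_writes w x)"
proof (cases "access a = Write \<and> loc a = x")
  case True
  then have "k < length (w @ [a]) \<and> access ((w @ [a]) ! k) = Write \<and> loc ((w @ [a]) ! k) = x \<and>
    (\<forall>l. k < l \<and> l < length (w @ [a]) \<longrightarrow>
      \<not> (access ((w @ [a]) ! l) = Write \<and> loc ((w @ [a]) ! l) = x)) \<longleftrightarrow> k = length w" for k
    by (cases k "length w" rule: linorder_cases) (auto intro: exI[of _ "length w"])
  then have "last_writes (w @ [a]) x = {event_at (w @ [a]) (length w)}"
    unfolding last_writes_def by simp
  with True show ?thesis by (simp add: event_at_def)
next
  case False
  have "event_at (w @ [a]) k = event_at w k \<and> (w @ [a]) ! k = w ! k" if "k < length w" for k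
    using that by (simp add: event_at_append_left nth_append)
  with False show ?thesis
    unfolding last_writes_def if_not_P[OF False]
    by (intro Collect_cong ex_cong1) (auto simp: less_Suc_eq)
qed

lemma last_write_before_append:
  "i < length w \<Longrightarrow> last_write_before (w @ u) i k \<longleftrightarrow> last_write_before w i k"
  unfolding last_write_before_def by (auto simp: nth_append)

text \<open>This turns reads-from into a left-to-right recursion whose state consists of the thread
  counts and \<open>last_writes\<close>.\<close>

lemma rf_snoc:
  "rf (w @ [a]) = rf w \<union>
    (if access a = Read then {(thread a, tcount (thread a) w)} \<times> last_writes w (loc a) else {})"
proof -
  have "rf (w @ [a]) = {(event_at (w @ [a]) i, event_at (w @ [a]) k) | i k.
      i < length w \<and> access ((w @ [a]) ! i) = Read \<and> last_write_before (w @ [a]) i k} \<union>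
    {(event_at (w @ [a]) (length w), event_at (w @ [a]) k) | k.
      access a = Read \<and> last_write_before (w @ [a]) (length w) k}" (is "_ = ?old \<union> ?new")
  proof -
    have "{(g i, g k) | i k. i < Suc n \<and> Q i \<and> P i k} =
        {(g i, g k) | i k. i < n \<and> Q i \<and> P i k} \<union> {(g n, g k) | k. Q n \<and> P n k}"
      for g :: "nat \<Rightarrow> 'a event" and P Q n
      unfolding less_Suc_eq by blast
    from this[where n = "length w"] show ?thesis unfolding rf_def by simp
  qed
  moreover have "?old = rf w"
  proof -
    have "last_write_before w i k \<Longrightarrow> i < length w \<Longrightarrow> event_at (w @ [a]) k = event_at w k" for i k
      by (simp add: last_write_before_def event_at_append_left)
    then show ?thesis unfolding rf_def
      by (intro Collect_cong ex_cong1)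
        (auto simp: event_at_append_left nth_append last_write_before_append)
  qed
  moreover have "?new =
    (if access a = Read then {(thread a, tcount (thread a) w)} \<times> last_writes w (loc a) else {})"
  proof -
    have "last_write_before (w @ [a]) (length w) k \<longleftrightarrow>
      k < length w \<and> access (w ! k) = Write \<and> loc (w ! k) = loc a \<and>
      (\<forall>l. k < l \<and> l < length w \<longrightarrow> \<not> (access (w ! l) = Write \<and> loc (w ! l) = loc a))" for k
      unfolding last_write_before_def by (auto simp: nth_append)
    moreover have "event_at (w @ [a]) (length w) = (thread a, tcount (thread a) w)"
      by (simp add: event_at_def)
    ultimately show ?thesis unfolding last_writes_def
      by (auto simp: event_at_append_left) (metis event_at_append_left)+
  qed
  ultimately show ?thesis by simp
qed

text \<open>If \<open>write_first x w\<close>, no read in \<open>w\<close> observes a write to \<open>x\<close> that precedes \<open>w\<close>.\<close>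
primrec write_first :: "'x \<Rightarrow> ('t, 'x) run \<Rightarrow> bool" where
  "write_first x [] = True"
| "write_first x (a # w) = (if loc a = x then access a = Write else write_first x w)"

lemma write_first_notin: "x \<notin> loc ` set w \<Longrightarrow> write_first x w"
  by (induction w) auto

lemma write_first_append:
  "write_first x (u @ w) \<longleftrightarrow> write_first x u \<and> (x \<in> loc ` set u \<or> write_first x w)"
  by (induction u) (auto simp: write_first_notin)

text \<open>What \<open>q\<close> adds to reads-from depends on the prefix only through the thread
  counts and the last writes it leaves behind. A discrepancy at the single location \<open>x\<close>
  is harmless if \<open>q\<close> overwrites \<open>x\<close> before reading it.\<close>

lemma rf_append_cong:
  assumes "\<And>b. b \<in> set q \<Longrightarrow> tcount (thread b) s = tcount (thread b) s'"
    and "\<And>y. y \<noteq> x \<Longrightarrow> last_writes s y = last_writes s' y"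
    and "last_writes s x = last_writes s' x \<or> write_first x q"
    and "rf s = rf s'"
  shows "rf (s @ q) = rf (s' @ q) \<and> (\<forall>y. y \<noteq> x \<longrightarrow> last_writes (s @ q) y = last_writes (s' @ q) y)"
  using assms
proof (induction q arbitrary: s s')
  case (Cons b q)
  have "rf ((s @ [b]) @ q) = rf ((s' @ [b]) @ q) \<and>
    (\<forall>y. y \<noteq> x \<longrightarrow> last_writes ((s @ [b]) @ q) y = last_writes ((s' @ [b]) @ q) y)"
  proof (rule Cons.IH)
    show "tcount (thread c) (s @ [b]) = tcount (thread c) (s' @ [b])" if "c \<in> set q" for c
      using Cons.prems(1)[of c] that by simp
    have b: "tcount (thread b) s = tcount (thread b) s'" using Cons.prems(1)[of b] by simp
    show "last_writes (s @ [b]) y = last_writes (s' @ [b]) y" if "y \<noteq> x" for y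
      using Cons.prems(2)[OF that] b by (simp add: last_writes_snoc)
    show "last_writes (s @ [b]) x = last_writes (s' @ [b]) x \<or> write_first x q"
      using Cons.prems(3) b by (auto simp: last_writes_snoc split: if_splits)
    \<comment> \<open>A letter on \<open>x\<close> either sees equal last writes or is itself a
      write, which adds no pair.\<close>
    show "rf (s @ [b]) = rf (s' @ [b])"
      using Cons.prems b by (cases "loc b = x") (auto simp: rf_snoc)
  qed
  then show ?case by simp
qed simp

section \<open>Postponing a write by a sliced reordering\<close>

definition events_after :: "('t, 'x) run \<Rightarrow> ('t, 'x) run \<Rightarrow> 't event list" where
  "events_after s q = map (\<lambda>k. (thread (q ! k),
    tcount (thread (q ! k)) s + tcount (thread (q ! k)) (take k q))) [0..<length q]"

lemma events_append: "events (s @ q) = events s @ events_after s q"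
proof (rule nth_equalityI)
  fix i assume "i < length (events (s @ q))"
  then show "events (s @ q) ! i = (events s @ events_after s q) ! i"
    using event_at_append_right[of s q "i - length s"]
    by (cases "i < length s")
      (auto simp: events_def events_after_def nth_append event_at_append_left)
qed (simp add: events_def events_after_def)

lemma events_after_cong:
  "(\<And>b. b \<in> set q \<Longrightarrow> tcount (thread b) s = tcount (thread b) s') \<Longrightarrow>
    events_after s q = events_after s' q"
  by (simp add: events_after_def)

lemma nths_block_left:
  fixes P E U Q :: "'b list"
  defines "I \<equiv> {k. k < length P \<or> length P + length E \<le> k \<and> k < length P + length E + length U}"
  shows "nths (P @ E @ U @ Q) I = P @ U" "nths (P @ E @ U @ Q) (- I) = E @ Q"
proof -
  have all: "nths l A = l" if "\<And>i. i < length l \<Longrightarrow> i \<in> A" for l :: "'b list" and A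
    using that by (simp add: nths_all)
  have none: "nths l A = []" if "\<And>i. i < length l \<Longrightarrow> i \<notin> A" for l :: "'b list" and A
    using that by (auto simp: nths_def filter_empty_conv dest: set_zip_rightD)
  show "nths (P @ E @ U @ Q) I = P @ U" "nths (P @ E @ U @ Q) (- I) = E @ Q"
    unfolding nths_append I_def by (subst all none; auto)+
qed

text \<open>The two slices are \<open>p @ u\<close> and \<open>[a] @ q\<close>. If \<open>u\<close>
  avoids the location of \<open>a\<close>, then \<open>q\<close> finds \<open>a\<close> as the last
  write there in both orders and may even observe it. Otherwise the last write found by
  \<open>q\<close> may change, so neither \<open>u\<close> nor \<open>q\<close> may observe anything
  older than itself at that location.\<close>

lemma sliced_postpone_write:
  assumes a: "access a = Write" and t: "\<And>b. b \<in> set u \<Longrightarrow> thread b \<noteq> thread a"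
    and x: "loc a \<notin> loc ` set u \<or> write_first (loc a) u \<and> write_first (loc a) q"
  shows "sliced (p @ [a] @ u @ q) (p @ u @ [a] @ q)"
proof -
  have cnt: "tcount (thread b) (p @ [a]) = tcount (thread b) p" if "b \<in> set u" for b
    using t[OF that] by simp
  have wu: "write_first (loc a) u" using x write_first_notin[of "loc a" u] by linarith
  have pu: "rf ((p @ [a]) @ u) = rf (p @ u) \<and>
    (\<forall>y. y \<noteq> loc a \<longrightarrow> last_writes ((p @ [a]) @ u) y = last_writes (p @ u) y)"
    by (rule rf_append_cong) (use cnt wu a in \<open>auto simp: last_writes_snoc rf_snoc\<close>)
  have same: "last_writes (w @ v) y = last_writes w y" if "y \<notin> loc ` set v"
    for w v :: "('a, 'b) run" and y
    using that by (induction v rule: rev_induct)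
      (auto simp: last_writes_snoc simp flip: append_assoc)
  have z: "tcount (thread a) u = 0" using t by (auto simp: filter_empty_conv)
  have "rf ((p @ [a] @ u) @ q) = rf ((p @ u @ [a]) @ q) \<and>
    (\<forall>y. y \<noteq> loc a \<longrightarrow> last_writes ((p @ [a] @ u) @ q) y = last_writes ((p @ u @ [a]) @ q) y)"
  proof (rule rf_append_cong)
    show "last_writes (p @ [a] @ u) (loc a) = last_writes (p @ u @ [a]) (loc a) \<or>
      write_first (loc a) q"
      using x a z same[of "loc a" u "p @ [a]"] last_writes_snoc[of "p @ u" a "loc a"]
      by (auto simp: last_writes_snoc)
    show "last_writes (p @ [a] @ u) y = last_writes (p @ u @ [a]) y" if "y \<noteq> loc a" for y
      using that pu last_writes_snoc[of "p @ u" a y] by simp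
    show "rf (p @ [a] @ u) = rf (p @ u @ [a])" using pu a rf_snoc[of "p @ u" a] by simp
  qed simp
  then have "rf_equiv (p @ [a] @ u @ q) (p @ u @ [a] @ q)"
    using t unfolding rf_equiv_def by (auto simp: filter_empty_conv)
  moreover have "events (p @ u @ [a] @ q) =
    nths (events (p @ [a] @ u @ q)) I @ nths (events (p @ [a] @ u @ q)) (- I)"
    if "I = {k. k < length p \<or> length p + 1 \<le> k \<and> k < length p + 1 + length u}" for I
  proof -
    have "events (((p @ [a]) @ u) @ q) = events p @ events_after p [a] @ events_after p u @
        events_after (p @ [a] @ u) q"
      unfolding events_append using cnt events_after_cong[of u "p @ [a]" p] by simp
    moreover have "events (((p @ u) @ [a]) @ q) = events p @ events_after p u @ events_after p [a] @
        events_after (p @ [a] @ u) q"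
    proof -
      have "events_after (p @ u) [a] = events_after p [a]" by (rule events_after_cong) (use z in simp)
      moreover have "events_after ((p @ u) @ [a]) q = events_after (p @ [a] @ u) q"
        by (rule events_after_cong) simp
      ultimately show ?thesis unfolding events_append by simp
    qed
    moreover have "length (events p) = length p" "length (events_after p [a]) = 1"
      "length (events_after p u) = length u" by (simp_all add: events_def events_after_def)
    ultimately show ?thesis
      using nths_block_left[of "events p" "events_after p [a]" "events_after p u"
          "events_after (p @ [a] @ u) q"] that by simp
  qed
  ultimately show ?thesis unfolding sliced_def by blast
qed

section \<open>The hard instances\<close>

text \<open>The parity keeps the overlapping sections \<open>j\<close> and \<open>j + 1\<close> on
  different locations while using only four of them. Location 4 remains for the final write of
  thread 0.\<close>

definition cell :: "nat \<Rightarrow> bool \<Rightarrow> nat" where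
  "cell j c = 2 * (j mod 2) + of_bool c"

lemma cell_less: "cell j c < 4"
  using mod_less_divisor[of 2 j] by (cases c) (simp_all add: cell_def del: mod_less_divisor)

lemma cell_neq_4 [simp]: "cell j c \<noteq> 4" "4 \<noteq> cell j c"
  using cell_less[of j c] by auto

lemma cell_Suc_neq [simp]: "cell (Suc j) c \<noteq> cell j d" "cell j d \<noteq> cell (Suc j) c"
proof -
  show "cell (Suc j) c \<noteq> cell j d" by (cases c; cases d) (simp_all add: cell_def, presburger+)
  then show "cell j d \<noteq> cell (Suc j) c" by metis
qed

lemma cell_eq_iff [simp]: "cell j c = cell j d \<longleftrightarrow> c = d"
  by (auto simp: cell_def)

text \<open>The writes to 4 after the first \<open>length a\<close> ones pad the run to an arbitrary length.\<close>
definition alice_letter :: "bool list \<Rightarrow> nat \<Rightarrow> (nat, nat) letter" where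
  "alice_letter a j = Letter 0 Write (if j < length a then cell j (a ! j) else 4)"

definition alice :: "bool list \<Rightarrow> nat \<Rightarrow> (nat, nat) run" where
  "alice a L = map (alice_letter a) [0..<L]"

text \<open>Opening section \<open>k\<close> before closing section \<open>k - 1\<close> within one
  block gives the hand-over-hand order. Block \<open>length b\<close> reads 4 in place of an
  opening, so this read lies inside the last section.\<close>

definition bob_block :: "bool list \<Rightarrow> nat \<Rightarrow> (nat, nat) run" where
  "bob_block b k =
    (if k = 0 then [Letter 1 Write (cell 0 (b ! 0))]
     else [if k < length b then Letter 1 Write (cell k (b ! k)) else Letter 1 Read 4,
       Letter 1 Read (cell (k - 1) (b ! (k - 1)))])"

definition bob_blocks :: "bool list \<Rightarrow> nat \<Rightarrow> nat \<Rightarrow> (nat, nat) run" where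
  "bob_blocks b k l = concat (map (bob_block b) [k..<l])"

definition bob :: "bool list \<Rightarrow> (nat, nat) run" where
  "bob b = bob_blocks b 0 (Suc (length b))"

lemma length_alice [simp]: "length (alice a L) = L"
  by (simp add: alice_def)

lemma nth_alice [simp]: "j < L \<Longrightarrow> alice a L ! j = alice_letter a j"
  by (simp add: alice_def)

lemma thread_alice: "l \<in> set (alice a L) \<Longrightarrow> thread l = 0"
  by (auto simp: alice_def alice_letter_def)

lemma thread_bob_blocks: "l \<in> set (bob_blocks b i k) \<Longrightarrow> thread l = 1"
  by (auto simp: bob_blocks_def bob_block_def split: if_splits)

lemma bob_blocks_split: "i \<le> j \<Longrightarrow> j \<le> k \<Longrightarrow> bob_blocks b i k = bob_blocks b i j @ bob_blocks b j k"
  unfolding bob_blocks_def using upt_add_eq_append[of i j "k - j"] by simp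

lemma bob_blocks_Suc: "i \<le> k \<Longrightarrow> bob_blocks b i (Suc k) = bob_blocks b i k @ bob_block b k"
  by (simp add: bob_blocks_def)

lemma bob_blocks_Cons: "i < k \<Longrightarrow> bob_blocks b i k = bob_block b i @ bob_blocks b (Suc i) k"
  by (simp add: bob_blocks_def upt_conv_Cons)

lemma length_bob_blocks: "length (bob_blocks b 0 (Suc k)) = 2 * k + 1"
  by (induction k) (simp_all add: bob_blocks_Suc bob_block_def bob_blocks_def)

lemma length_bob [simp]: "length (bob b) = 2 * length b + 1"
  by (simp add: bob_def length_bob_blocks)

lemma nth_bob_0: "bob b ! 0 = Letter 1 Write (cell 0 (b ! 0))"
  by (simp add: bob_def bob_blocks_Cons bob_block_def)

lemma nth_bob_block:
  assumes "k \<le> length b" "0 < k" "i < 2"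
  shows "bob b ! (2 * k - 1 + i) = bob_block b k ! i"
proof -
  have "bob b = bob_blocks b 0 k @ bob_block b k @ bob_blocks b (Suc k) (Suc (length b))"
    unfolding bob_def using assms bob_blocks_split[of 0 k "Suc (length b)" b]
      bob_blocks_Cons[of k "Suc (length b)" b] by simp
  moreover have "length (bob_blocks b 0 k) = 2 * k - 1"
    using assms length_bob_blocks[of b "k - 1"] by simp
  moreover have "length (bob_block b k) = 2" using assms by (simp add: bob_block_def)
  ultimately show ?thesis using assms
    by (metis nth_append_length_plus nth_append_left)
qed

text \<open>
  Section \<open>k\<close> of \<open>bob b\<close> extends from position \<open>2 * k - 1\<close> to \<open>2 * k + 2\<close>; truncated subtraction
  gives the right opening position 0 for \<open>k = 0\<close>.
\<close>
lemma nth_bob_write: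
  assumes "k < length b"
  shows "bob b ! (2 * k - 1) = Letter 1 Write (cell k (b ! k))"
  using assms nth_bob_block[of k b 0] nth_bob_0[of b]
  by (cases "k = 0") (simp_all add: bob_block_def)

lemma nth_bob_read:
  assumes "k < length b"
  shows "bob b ! (2 * k + 2) = Letter 1 Read (cell k (b ! k))"
  using assms nth_bob_block[of "Suc k" b 1] by (simp add: bob_block_def)

lemma nth_bob_last:
  assumes "0 < length b"
  shows "bob b ! (2 * length b - 1) = Letter 1 Read 4"
  using assms nth_bob_block[of "length b" b 0] by (simp add: bob_block_def)

lemma nth_bob_even_access:
  assumes "0 < k" "k \<le> length b"
  shows "access (bob b ! (2 * k)) = Read"
  using assms nth_bob_block[of k b 1] by (simp add: bob_block_def)

lemma nth_bob_no_write_4: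
  assumes "k < length (bob b)" "loc (bob b ! k) = 4"
  shows "access (bob b ! k) = Read"
proof -
  have "bob b ! k \<in> set (bob b)" using assms by simp
  with assms(2) show ?thesis
    by (auto simp: bob_def bob_blocks_def bob_block_def split: if_splits)
qed

lemma event_at_alice:
  assumes "j < L"
  shows "event_at (alice a L @ v) j = (0, j)"
proof -
  have "filter (\<lambda>l. thread l = 0) (take j (alice a L)) = take j (alice a L)"
    by (intro filter_True ballI) (metis thread_alice in_set_takeD)
  then show ?thesis using assms
    by (simp add: event_at_append_left) (simp add: event_at_def alice_letter_def)
qed

lemma event_at_bob:
  assumes "k < length (bob b)"
  shows "event_at (alice a L @ bob b) (L + k) = (1, k)"
proof -
  have "filter (\<lambda>l. thread l = 1) (take k (bob b)) = take k (bob b)"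
    unfolding bob_def by (intro filter_True ballI) (metis thread_bob_blocks in_set_takeD)
  moreover have "filter (\<lambda>l. thread l = 1) (alice a L) = []"
    using thread_alice[of _ a L] by (fastforce simp: filter_empty_conv)
  moreover have "thread (bob b ! k) = 1"
    using thread_bob_blocks[of "bob b ! k"] assms unfolding bob_def by (metis nth_mem)
  ultimately show ?thesis using assms event_at_append_right[of "alice a L" "bob b" k] by simp
qed

section \<open>Reads-from pairs of the hard instances\<close>

lemma rfI:
  assumes "i < length w" "access (w ! i) = Read" "last_write_before w i k"
    "event_at w i = f" "event_at w k = e"
  shows "(f, e) \<in> rf w"
  using assms unfolding rf_def by blast

lemma rf_bob_section:
  assumes "k < length b"
  shows "((1, 2 * k + 2), (1, 2 * k - 1)) \<in> rf (alice a L @ bob b)"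
proof (rule rfI)
  let ?w = "alice a L @ bob b"
  have nth: "?w ! (L + i) = bob b ! i" for i by (simp add: nth_append)
  have "\<not> (access (?w ! l) = Write \<and> loc (?w ! l) = cell k (b ! k))"
    if l: "L + (2 * k - 1) < l" "l < L + (2 * k + 2)" for l
  proof -
    \<comment> \<open>Inside section \<open>k\<close> lie the close of section \<open>k - 1\<close>
      and the opening of section \<open>k + 1\<close> (or the read of 4). For \<open>k = 0\<close>
      only the latter exists, since \<open>2 * k - 1\<close> is truncated to 0.\<close>
    from l consider "0 < k" "l = L + 2 * k" | "l = L + (2 * k + 1)"
      by (cases "k = 0") (auto, linarith)
    then show ?thesis
    proof cases
      case 1
      then show ?thesis using assms nth[of "2 * k"] nth_bob_even_access[of k b] by simp
    next
      case 2
      show ?thesis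
      proof (cases "Suc k = length b")
        case True
        then have "2 * length b - 1 = 2 * k + 1" "0 < length b" by linarith+
        then show ?thesis using 2 nth[of "2 * k + 1"] nth_bob_last[of b] by auto
      next
        case False
        with 2 assms show ?thesis
          using nth[of "2 * k + 1"] nth_bob_write[of "Suc k" b] by auto
      qed
    qed
  qed
  then show "last_write_before ?w (L + (2 * k + 2)) (L + (2 * k - 1))"
    unfolding last_write_before_def nth nth_bob_write[OF assms] nth_bob_read[OF assms] by auto
  show "access (?w ! (L + (2 * k + 2))) = Read"
    unfolding nth nth_bob_read[OF assms] by simp
  show "event_at ?w (L + (2 * k + 2)) = (1, 2 * k + 2)" "event_at ?w (L + (2 * k - 1)) = (1, 2 * k - 1)"
    by (intro event_at_bob; use assms in simp)+
qed (use assms in simp)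

text \<open>As \<open>length a < L\<close>, the last letter of thread 0 is a write to 4, and thread
  1 never writes to 4.\<close>

lemma rf_bob_alice:
  assumes "0 < length b" "length a < L"
  shows "((1, 2 * length b - 1), (0, L - 1)) \<in> rf (alice a L @ bob b)"
proof (rule rfI)
  let ?w = "alice a L @ bob b"
  define z where "z = 2 * length b - 1"
  have nth: "?w ! (L + i) = bob b ! i" for i by (simp add: nth_append)
  have z: "?w ! (L + z) = Letter 1 Read 4" "z < length (bob b)"
    using assms nth_bob_last[OF assms(1)] by (simp_all only: nth flip: z_def) (simp add: z_def)
  have last: "?w ! (L - 1) = Letter 0 Write 4"
    using assms by (simp add: nth_append alice_letter_def)
  have "\<not> (access (?w ! l) = Write \<and> loc (?w ! l) = 4)" if "L - 1 < l" "l < L + z" for l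
  proof -
    from that z have "l = L + (l - L)" "l - L < length (bob b)" by auto
    then show ?thesis using nth[of "l - L"] nth_bob_no_write_4[of "l - L" b] by auto
  qed
  then show "last_write_before ?w (L + z) (L - 1)"
    unfolding last_write_before_def z last using assms by auto
  show "L + z < length ?w" "event_at ?w (L + z) = (1, 2 * length b - 1)"
    using z event_at_bob[of z b a L] by (simp_all add: z_def)
  show "access (?w ! (L + z)) = Read" by (simp add: z)
  show "event_at ?w (L - 1) = (0, L - 1)" using assms by (intro event_at_alice) auto
qed

section \<open>Equal bit strings: the flip is impossible\<close>

lemma sliced_star_rf_equiv: "sliced\<^sup>*\<^sup>* \<sigma> \<rho> \<Longrightarrow> rf_equiv \<sigma> \<rho>"
  by (induction rule: rtranclp_induct) (auto simp: rf_equiv_def sliced_def)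

text \<open>A write strictly between \<open>k\<close> and \<open>i\<close> would hide the write at
  \<open>k\<close> from the read at \<open>i\<close>. The alternative \<open>g = f\<close> stands
  for \<open>l = i\<close>; in the application it is refuted because the two events belong to
  different threads.\<close>

lemma no_write_in_section:
  assumes "(f, e) \<in> rf \<rho>" "event_at \<rho> i = f" "event_at \<rho> k = e" "event_at \<rho> l = g"
    "i < length \<rho>" "k < length \<rho>" "l < length \<rho>"
    "access (\<rho> ! l) = Write" "loc (\<rho> ! l) = loc (\<rho> ! k)" "k < l"
  shows "i < l \<or> g = f"
proof -
  from assms(1) obtain i' k' where "i' < length \<rho>" "last_write_before \<rho> i' k'"
    "event_at \<rho> i' = f" "event_at \<rho> k' = e" unfolding rf_def by auto
  moreover from this have "i' = i" "k' = k"
    using assms event_at_inj[of \<rho>] by (auto simp: last_write_before_def)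
  ultimately show ?thesis
    using assms unfolding last_write_before_def by (metis linorder_cases)
qed

lemma rf_before:
  assumes "(f, e) \<in> rf \<rho>" "event_at \<rho> i = f" "event_at \<rho> k = e" "i < length \<rho>" "k < length \<rho>"
  shows "k < i"
proof -
  from assms(1) obtain i' k' where "i' < length \<rho>" "k' < i'"
    "event_at \<rho> i' = f" "event_at \<rho> k' = e" unfolding rf_def last_write_before_def by auto
  moreover from this have "i' = i" "k' = k" using assms event_at_inj[of \<rho>] by auto
  ultimately show ?thesis by simp
qed

text \<open>Reads-from equivalence alone already forbids the flip, so the individual reordering
  steps are forgotten at once.\<close>

lemma not_flippable_same_bits:
  assumes "0 < length a" "length a < L"
  shows "\<not> flippable (alice a L @ bob a) (0, 0) (1, 0)"
proof
  let ?w = "alice a L @ bob a" and ?m = "length a"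
  assume "flippable ?w (0, 0) (1, 0)"
  then obtain \<rho> where eq: "rf_equiv ?w \<rho>"
    and fl: "before ?w (0, 0) (1, 0) \<and> before \<rho> (1, 0) (0, 0) \<or> before ?w (1, 0) (0, 0)"
    unfolding flippable_def using sliced_star_rf_equiv by blast
  have "\<not> before ?w (1, 0) (0, 0)"
  proof
    assume "before ?w (1, 0) (0, 0)"
    then obtain i j where "i < j" "j < length ?w" "event_at ?w i = (1, 0)" "event_at ?w j = (0, 0)"
      unfolding before_def by blast
    moreover have "event_at ?w 0 = (0, 0)" using assms by (intro event_at_alice) simp
    ultimately have "j = 0" using event_at_inj[of ?w j 0] by force
    with \<open>i < j\<close> show False by simp
  qed
  with fl obtain p0 q0 where pq0: "q0 < p0" "p0 < length \<rho>"
    "event_at \<rho> q0 = (1, 0)" "event_at \<rho> p0 = (0, 0)" unfolding before_def by blast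
  have "filter (\<lambda>l. thread l = 0) (alice a L) = alice a L"
    "filter (\<lambda>l. thread l = 1) (alice a L) = []"
    using thread_alice[of _ a L] by (auto simp: filter_id_conv filter_empty_conv)
  moreover have "filter (\<lambda>l. thread l = 0) (bob a) = []"
    "filter (\<lambda>l. thread l = 1) (bob a) = bob a"
    using thread_bob_blocks[of _ a 0 "Suc (length a)"]
    by (auto simp: bob_def filter_id_conv filter_empty_conv)
  moreover have "filter (\<lambda>l. thread l = t) \<rho> = filter (\<lambda>l. thread l = t) ?w" for t
    using eq unfolding rf_equiv_def by simp
  ultimately have proj: "filter (\<lambda>l. thread l = 0) \<rho> = alice a L" "filter (\<lambda>l. thread l = 1) \<rho> = bob a"
    by simp_all
  have rf: "rf \<rho> = rf ?w" using eq unfolding rf_equiv_def by simp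
  \<comment> \<open>Positions in \<open>\<rho>\<close>: \<open>p j\<close> for event
    \<open>j\<close> of thread 0 and, below, \<open>q k\<close> for event \<open>k\<close> of thread
    1.\<close>
  define p where "p j = (SOME i. i < length \<rho> \<and> event_at \<rho> i = (0, j) \<and> \<rho> ! i = alice a L ! j)" for j
  have p: "p j < length \<rho> \<and> event_at \<rho> (p j) = (0, j) \<and> \<rho> ! p j = alice_letter a j" if "j < L" for j
    using someI_ex[OF event_at_exists[of j 0 \<rho>, unfolded proj length_alice, OF that]] that
    by (simp add: p_def)
  define q where "q k = (SOME i. i < length \<rho> \<and> event_at \<rho> i = (1, k) \<and> \<rho> ! i = bob a ! k)" for k
  have q: "q k < length \<rho> \<and> event_at \<rho> (q k) = (1, k) \<and> \<rho> ! q k = bob a ! k" if "k < 2 * ?m + 1" for k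
    using someI_ex[OF event_at_exists[of k 1 \<rho>, unfolded proj length_bob, OF that]]
    unfolding q_def .
  \<comment> \<open>Write \<open>j\<close> has the location of section \<open>j\<close> because the
    bits agree; once the section is open, the write has to wait for its close.\<close>
  have step: "q (2 * j + 2) < p j" if "j < ?m" "q (2 * j - 1) < p j" for j
  proof -
    have "((1, 2 * j + 2), (1, 2 * j - 1)) \<in> rf \<rho>" unfolding rf using that(1) by (rule rf_bob_section)
    then have "q (2 * j + 2) < p j \<or> (0, j) = (1 :: nat, 2 * j + 2)"
    proof (rule no_write_in_section)
      show "access (\<rho> ! p j) = Write" "loc (\<rho> ! p j) = loc (\<rho> ! q (2 * j - 1))"
        using p[of j] q[of "2 * j - 1"] that assms nth_bob_write[of j a]
        by (auto simp: alice_letter_def)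
    qed (use p[of j] q[of "2 * j - 1"] q[of "2 * j + 2"] that assms in auto)
    then show ?thesis by simp
  qed
  have ahead: "j < ?m \<Longrightarrow> q (2 * j - 1) < p j" for j
  proof (induction j)
    case 0
    have "q 0 = q0" "p 0 = p0" using pq0 p[of 0] q[of 0] assms event_at_inj[of \<rho>] by auto
    then show ?case using pq0 by simp
  next
    case (Suc j)
    \<comment> \<open>Hand over hand: section \<open>j + 1\<close> opens before section
      \<open>j\<close> closes.\<close>
    have "q (2 * Suc j - 1) < q (2 * j + 2)"
      by (rule event_at_less[where w = \<rho> and t = 1 and k = "2 * Suc j - 1" and l = "2 * j + 2"]) (use q Suc.prems in auto)
    also have "\<dots> < p j" using Suc by (intro step) auto
    also have "p j < p (Suc j)"
      by (rule event_at_less[where w = \<rho> and t = 0 and k = j and l = "Suc j"]) (use p Suc.prems assms in auto)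
    finally show ?case .
  qed
  \<comment> \<open>All sections close before the final write of thread 0, yet the read observing it
    lies inside the last section: the chain below is a cycle at \<open>q (2 * ?m)\<close>.\<close>
  have lt: "?m - 1 < L - 1" using assms by linarith
  have "2 * (?m - 1) + 2 = 2 * ?m" using assms by linarith
  then have "q (2 * ?m) < p (?m - 1)" using assms step[OF _ ahead, of "?m - 1"] by simp
  also have "p (?m - 1) < p (L - 1)"
    by (rule event_at_less[where w = \<rho> and t = 0 and k = "?m - 1" and l = "L - 1"]) (use p assms lt in auto)
  also have "p (L - 1) < q (2 * ?m - 1)"
    by (rule rf_before[OF rf_bob_alice[OF assms, folded rf]]) (use p q assms in auto)
  also have "q (2 * ?m - 1) < q (2 * ?m)"
    by (rule event_at_less[where w = \<rho> and t = 1 and k = "2 * ?m - 1" and l = "2 * ?m"]) (use q assms in auto)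
  finally show False .
qed

section \<open>Different bit strings: a schedule with the flip\<close>

text \<open>Each pair holds an inserted letter and the index of the block that it immediately
  precedes; \<open>k\<close> is the next block due.\<close>

primrec weave :: "bool list \<Rightarrow> nat \<Rightarrow> ((nat, nat) letter \<times> nat) list \<Rightarrow> (nat, nat) run" where
  "weave b k [] = bob_blocks b k (Suc (length b))"
| "weave b k (c # cs) = bob_blocks b k (snd c) @ fst c # weave b (snd c) cs"

lemma weave_split:
  assumes "k \<le> l" "l \<le> Suc (length b)" "\<forall>c \<in> set cs. l \<le> snd c"
  shows "weave b k cs = bob_blocks b k l @ weave b l cs"
proof (cases cs)
  case Nil
  then show ?thesis using assms bob_blocks_split[of k l "Suc (length b)" b] by simp
next
  case (Cons c cs')
  then show ?thesis using assms bob_blocks_split[of k l "snd c" b] by simp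
qed

text \<open>An inserted write can only turn the first access to \<open>x\<close> into a write. The
  prefix \<open>p\<close> collects what the induction has passed.\<close>

lemma write_first_weave:
  assumes "write_first x (p @ bob_blocks b k (Suc (length b)))"
    "sorted (k # map snd cs)" "\<forall>c \<in> set cs. snd c \<le> Suc (length b) \<and> access (fst c) = Write"
  shows "write_first x (p @ weave b k cs)"
  using assms
proof (induction cs arbitrary: p k)
  case (Cons c cs)
  have "write_first x ((p @ bob_blocks b k (snd c) @ [fst c]) @ weave b (snd c) cs)"
  proof (rule Cons.IH)
    have "bob_blocks b k (Suc (length b)) =
        bob_blocks b k (snd c) @ bob_blocks b (snd c) (Suc (length b))"
      using Cons.prems by (intro bob_blocks_split) auto
    with Cons.prems(1)
    have "write_first x (p @ bob_blocks b k (snd c) @ bob_blocks b (snd c) (Suc (length b)))"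
      by (simp only:)
    then show "write_first x ((p @ bob_blocks b k (snd c) @ [fst c]) @ bob_blocks b (snd c) (Suc (length b)))"
      using Cons.prems(3) by (simp add: write_first_append) blast
  qed (use Cons.prems in auto)
  then show ?case by simp
qed simp

text \<open>Every section closed in a block after block \<open>k\<close> was opened in the block
  before, hence within the range. Only the read of 4 and the close of section \<open>k - 1\<close>
  in block \<open>k\<close> lack their write, and the hypotheses exclude both locations.\<close>

lemma write_first_bob_blocks:
  assumes "x \<noteq> 4" "l \<le> Suc (length b)" "k = 0 \<or> x \<noteq> cell (k - 1) (b ! (k - 1))"
  shows "write_first x (bob_blocks b k l)"
  using assms(2)
proof (induction l)
  case (Suc l)
  show ?case
  proof (cases "k \<le> l")
    case True
    have "x \<in> loc ` set (bob_blocks b k l) \<or> write_first x (bob_block b l)"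
    proof (cases "l = k \<or> x \<noteq> cell (l - 1) (b ! (l - 1))")
      case True
      then show ?thesis using assms by (auto simp: bob_block_def)
    next
      case False
      with True obtain l' where l': "l = Suc l'" "k \<le> l'" by (cases l) auto
      have "Letter 1 Write (cell l' (b ! l')) \<in> set (bob_block b l')"
        using l' Suc.prems by (auto simp: bob_block_def)
      then have "Letter 1 Write (cell l' (b ! l')) \<in> set (bob_blocks b k l)"
        using l' by (simp add: bob_blocks_Suc)
      with False l' show ?thesis by force
    qed
    with Suc True show ?thesis by (simp add: bob_blocks_Suc write_first_append)
  qed (simp add: bob_blocks_def)
qed (simp add: bob_blocks_def)

text \<open>
  In the final schedule, write \<open>j\<close> comes immediately before block \<open>slot i m j\<close>, i.e. while section
  \<open>slot i m j - 1\<close> is the only open one: this is section \<open>j + 1\<close> before the mismatch \<open>i\<close>, section \<open>i\<close>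
  at the mismatch, and section \<open>j - 1\<close> after it.
\<close>
definition slot :: "nat \<Rightarrow> nat \<Rightarrow> nat \<Rightarrow> nat" where
  "slot i m j = (if j < i then j + 2 else if j = i then i + 1 else min j m)"

lemma slot_mono: "i < m \<Longrightarrow> j \<le> j' \<Longrightarrow> slot i m j \<le> slot i m j'"
  by (auto simp: slot_def)

lemma slot_le: "i < m \<Longrightarrow> slot i m j \<le> m"
  by (auto simp: slot_def)

text \<open>Interpolates between the hard instance at \<open>r = L\<close> and the final schedule at
  \<open>r = 0\<close>.\<close>

definition half_woven :: "bool list \<Rightarrow> bool list \<Rightarrow> nat \<Rightarrow> nat \<Rightarrow> nat \<Rightarrow> (nat, nat) run" where
  "half_woven a b L i r = take r (alice a L) @
    weave b 0 (map (\<lambda>j. (alice_letter a j, slot i (length b) j)) [r..<L])"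

text \<open>By monotonicity of \<open>slot\<close> the later writes stay at or beyond the slot of
  write \<open>r\<close>, so this write passes blocks of thread 1 only.\<close>

lemma sliced_half_woven:
  assumes len: "length a = length b" and i: "i < length b" "a ! i \<noteq> b ! i" and r: "r < L"
  shows "sliced (half_woven a b L i (Suc r)) (half_woven a b L i r)"
proof -
  let ?m = "length b" and ?k = "slot i (length b) r"
  let ?c = "\<lambda>j. (alice_letter a j, slot i (length b) j)"
  let ?cs = "map ?c [Suc r..<L]"
  have k: "?k \<le> ?m" using i(1) by (rule slot_le)
  have later: "?k \<le> slot i ?m j" if "r \<le> j" for j using i(1) that by (rule slot_mono)
  have "sorted_wrt (\<lambda>j j'. slot i ?m j \<le> slot i ?m j') [Suc r..<L]"
    by (rule sorted_wrt_mono_rel[OF _ sorted_upt]) (use i in \<open>auto intro: slot_mono\<close>)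
  then have sorted: "sorted (?k # map snd ?cs)"
    using later by (auto simp: sorted_map comp_def sorted_wrt_map)
  have "weave b 0 ?cs = bob_blocks b 0 ?k @ weave b ?k ?cs"
    using k later by (intro weave_split) auto
  moreover have "take (Suc r) (alice a L) = take r (alice a L) @ [alice_letter a r]"
    using r by (simp add: take_Suc_conv_app_nth)
  moreover have "map ?c [r..<L] = ?c r # ?cs" using r by (simp add: upt_conv_Cons)
  moreover have "sliced (take r (alice a L) @ [alice_letter a r] @ bob_blocks b 0 ?k @ weave b ?k ?cs)
    (take r (alice a L) @ bob_blocks b 0 ?k @ [alice_letter a r] @ weave b ?k ?cs)"
  proof (rule sliced_postpone_write)
    let ?x = "loc (alice_letter a r)"
    show "access (alice_letter a r) = Write" by (simp add: alice_letter_def)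
    show "thread l \<noteq> thread (alice_letter a r)" if "l \<in> set (bob_blocks b 0 ?k)" for l
      using thread_bob_blocks[OF that] by (simp add: alice_letter_def)
    show "?x \<notin> loc ` set (bob_blocks b 0 ?k) \<or>
      write_first ?x (bob_blocks b 0 ?k) \<and> write_first ?x (weave b ?k ?cs)"
    proof (cases "r < ?m")
      case True
      then have x: "?x = cell r (a ! r)" using len by (simp add: alice_letter_def)
      have "?k = 0 \<or> ?x \<noteq> cell (?k - 1) (b ! (?k - 1))"
      proof -
        \<comment> \<open>The open section is \<open>r + 1\<close>, \<open>r\<close> or
          \<open>r - 1\<close>: the first and the last differ from write \<open>r\<close> in parity,
          the middle one in the bit.\<close>
        consider "r < i" | "r = i" | r' where "r = Suc r'" "i < r" by (cases r) force+
        then show ?thesis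
          using i(2) True x by cases (simp_all add: slot_def)
      qed
      then have "write_first ?x ([] @ weave b ?k ?cs)"
        using k later x sorted i(1) slot_le[OF i(1)]
        by (intro write_first_weave) (auto intro: write_first_bob_blocks le_SucI simp: alice_letter_def)
      moreover have "write_first ?x (bob_blocks b 0 ?k)"
        using k x by (intro write_first_bob_blocks) auto
      ultimately show ?thesis by simp
    next
      case False
      then have "?x = 4" using len by (simp add: alice_letter_def)
      \<comment> \<open>Thread 1 accesses 4 only in block \<open>?m\<close>, which is not passed
        because \<open>?k\<close> is at most \<open>?m\<close>.\<close>
      moreover have "4 \<notin> loc ` set (bob_blocks b 0 ?k)"
        using k by (auto simp: bob_blocks_def bob_block_def split: if_splits)
      ultimately show ?thesis by simp
    qed
  qed
  ultimately show ?thesis by (simp add: half_woven_def)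
qed

lemma flippable_different_bits:
  assumes "length a = length b" "length a < L" "a \<noteq> b"
  shows "flippable (alice a L @ bob b) (0, 0) (1, 0)"
proof -
  obtain i where i: "i < length b" "a ! i \<noteq> b ! i"
    using assms by (auto simp: list_eq_iff_nth_eq)
  have "sliced\<^sup>*\<^sup>* (half_woven a b L i L) (half_woven a b L i (L - d))" if "d \<le> L" for d
    using that
  proof (induction d)
    case (Suc d)
    then have "sliced (half_woven a b L i (L - d)) (half_woven a b L i (L - Suc d))"
      using sliced_half_woven[OF assms(1) i, of "L - Suc d" L] by (simp add: Suc_diff_Suc)
    with Suc show ?case by auto
  qed simp
  from this[of L] have "sliced\<^sup>*\<^sup>* (alice a L @ bob b) (half_woven a b L i 0)"
    by (simp add: half_woven_def bob_def)
  moreover have "before (alice a L @ bob b) (0, 0) (1, 0)"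
    unfolding before_def using assms event_at_alice[of 0 L a "bob b"] event_at_bob[of 0 b a L]
    by (intro exI[of _ 0] exI[of _ L]) auto
  moreover have "before (half_woven a b L i 0) (1, 0) (0, 0)"
  proof -
    let ?k = "slot i (length b) 0"
    obtain v where v: "half_woven a b L i 0 = bob_blocks b 0 ?k @ alice_letter a 0 # v"
      using assms unfolding half_woven_def by (simp add: upt_conv_Cons)
    \<comment> \<open>The slot of write 0 is 1 or 2, so block 0, with the first event of thread 1,
      precedes it.\<close>
    have "0 < ?k" using i by (auto simp: slot_def)
    then obtain u where u: "bob_blocks b 0 ?k = Letter 1 Write (cell 0 (b ! 0)) # u"
      by (simp add: bob_blocks_Cons bob_block_def)
    have "filter (\<lambda>l. thread l = 0) (bob_blocks b 0 ?k) = []"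
      using thread_bob_blocks[of _ b 0 ?k] by (fastforce simp: filter_empty_conv)
    then have "event_at (half_woven a b L i 0) (length (bob_blocks b 0 ?k)) = (0, 0)"
      unfolding v using event_at_append_right[of "bob_blocks b 0 ?k" "alice_letter a 0 # v" 0]
      by (simp add: alice_letter_def)
    moreover have "event_at (half_woven a b L i 0) 0 = (1, 0)"
      unfolding v u by (simp add: event_at_def)
    ultimately show ?thesis unfolding before_def
      by (intro exI[of _ 0] exI[of _ "length (bob_blocks b 0 ?k)"]) (simp add: v u)
  qed
  ultimately show ?thesis unfolding flippable_def by blast
qed

section \<open>Crossing sequences\<close>

fun crosses :: "nat \<Rightarrow> config \<Rightarrow> config \<Rightarrow> bool" where
  "crosses N (Running m h) (Running m' h') \<longleftrightarrow> (h < N) \<noteq> (h' < N)"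
| "crosses N _ _ \<longleftrightarrow> False"

primrec crossings :: "'a algorithm \<Rightarrow> 'a list \<Rightarrow> nat \<Rightarrow> nat \<Rightarrow> config \<Rightarrow> bool list list" where
  "crossings A w N 0 c = []"
| "crossings A w N (Suc k) c =
    (if crosses N c (next_config A w c) then [memory (next_config A w c)] else []) @
    crossings A w N k (next_config A w c)"

lemma funpow_Halted: "(next_config A w ^^ k) (Halted m b) = Halted m b"
  by (induction k) auto

lemma crossings_Halted: "crossings A w N k (Halted m b) = []"
  by (induction k) auto

lemma halts_unique:
  assumes "config_after A w k = Halted m b" "config_after A w k' = Halted m' b'"
  shows "b = b'"
proof -
  have "config_after A w (k + k') = Halted m' b'" "config_after A w (k' + k) = Halted m b"
    using assms unfolding config_after_def
    by (simp_all only: funpow_add comp_apply funpow_Halted)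
  then show ?thesis by (simp add: add.commute)
qed

text \<open>Equal lengths matter because \<open>Advance\<close> stops the head at the end of the
  input.\<close>

lemma next_config_left:
  assumes "h < length x" "length y = length y'"
  shows "next_config A (x @ y) (Running m h) = next_config A (x @ y') (Running m h)"
  using assms by (simp add: symbol_at_def nth_append)

lemma next_config_right:
  assumes "length x \<le> h" "length x = length x'"
  shows "next_config A (x @ y) (Running m h) = next_config A (x' @ y) (Running m h)"
  using assms by (simp add: symbol_at_def nth_append)

lemma cross_right:
  assumes "next_config A w (Running m h) = Running m' h'" "h < N" "N \<le> h'" "N \<le> length w"
  shows "h' = N"
  using assms by (auto split: prod.splits action.splits)

lemma cross_left:
  assumes "next_config A w (Running m h) = Running m' h'" "N \<le> h" "h' < N" "N \<le> length w"
  shows "h' = 0 \<and> snd (step A m (symbol_at w h)) = Rewind"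
  using assms by (auto split: prod.splits action.splits)

text \<open>
  The head enters the right half only at its first symbol and the left half only at symbol 0, so the
  recorded memory determines the configuration after a crossing.
\<close>
lemma cut_and_paste:
  assumes x: "length x = length x'" "0 < length x" and y: "length y = length y'"
  shows "(next_config A (x @ y) ^^ k) (Running m h) = Halted \<mu> d \<Longrightarrow>
    (next_config A (x' @ y') ^^ k') (Running m' h') = Halted \<mu>' d \<Longrightarrow>
    crossings A (x @ y) (length x) k (Running m h) =
      crossings A (x' @ y') (length x) k' (Running m' h') \<Longrightarrow>
    (h < length x) = (h' < length x) \<Longrightarrow>
    \<exists>l \<nu>. (next_config A (x @ y') ^^ l) (if h < length x then Running m h else Running m' h') =
      Halted \<nu> d"
\<comment> \<open>Only the run owning the half under the heads is copied to \<open>x @ y'\<close>.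
  When it is about to cross, the other run is advanced alone until it crosses too, so the measure is
  the sum of the step counts.\<close>
proof (induction "k + k'" arbitrary: k k' m m' h h' rule: less_induct)
  case less
  let ?N = "length x"
  let ?f = "next_config A (x @ y)" and ?f' = "next_config A (x' @ y')" and ?g = "next_config A (x @ y')"
  obtain k1 where k1: "k = Suc k1" using less.prems(1) by (cases k) auto
  obtain k1' where k1': "k' = Suc k1'" using less.prems(2) by (cases k') auto
  define c1 where "c1 = ?f (Running m h)"
  define c1' where "c1' = ?f' (Running m' h')"
  have run: "(?f ^^ k1) c1 = Halted \<mu> d" "(?f' ^^ k1') c1' = Halted \<mu>' d"
    using less.prems(1,2) unfolding k1 k1' funpow_Suc_right c1_def c1'_def by simp_all
  have cr: "crossings A (x @ y) ?N k (Running m h) =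
      (if crosses ?N (Running m h) c1 then [memory c1] else []) @ crossings A (x @ y) ?N k1 c1"
    "crossings A (x' @ y') ?N k' (Running m' h') =
      (if crosses ?N (Running m' h') c1' then [memory c1'] else []) @ crossings A (x' @ y') ?N k1' c1'"
    unfolding k1 k1' c1_def c1'_def by simp_all
  have both: "c1 = c1' \<and> (\<exists>l \<nu>. (?g ^^ l) c1 = Halted \<nu> d)"
    if crs: "crosses ?N (Running m h) c1" "crosses ?N (Running m' h') c1'"
  proof -
    obtain m1 h1 where c1: "c1 = Running m1 h1" "(h < ?N) \<noteq> (h1 < ?N)"
      using crs(1) by (cases c1) auto
    obtain m1' h1' where c1': "c1' = Running m1' h1'" "(h' < ?N) \<noteq> (h1' < ?N)"
      using crs(2) by (cases c1') auto
    have "m1 = m1'" and tl: "crossings A (x @ y) ?N k1 c1 = crossings A (x' @ y') ?N k1' c1'"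
      using less.prems(3) crs unfolding cr by (auto simp: c1 c1')
    have "h1 = h1'"
    proof (cases "h < ?N")
      case True
      then show ?thesis
        using cross_right[of A "x @ y" m h m1 h1 ?N] cross_right[of A "x' @ y'" m' h' m1' h1' ?N]
          c1 c1' c1_def c1'_def less.prems(4) x by auto
    next
      case False
      then show ?thesis
        using cross_left[of A "x @ y" m h m1 h1 ?N] cross_left[of A "x' @ y'" m' h' m1' h1' ?N]
          c1 c1' c1_def c1'_def less.prems(4) x by auto
    qed
    have "\<exists>l \<nu>. (?g ^^ l) (if h1 < ?N then Running m1 h1 else Running m1' h1') = Halted \<nu> d"
      using k1 k1' \<open>h1 = h1'\<close> by (intro less.hyps[OF _ run[unfolded c1 c1'] tl[unfolded c1 c1']]) auto
    then show ?thesis unfolding c1 c1' \<open>m1 = m1'\<close> \<open>h1 = h1'\<close> by simp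
  qed
  show ?case
  proof (cases "h < ?N")
    case True
    have g: "?g (Running m h) = c1" unfolding c1_def using next_config_left[OF True y] by simp
    have ex: "\<exists>l \<nu>. (?g ^^ l) c1 = Halted \<nu> d"
      if nc: "\<not> crosses ?N (Running m h) c1"
    proof (cases c1)
      case (Running m1 h1)
      with nc True have "h1 < ?N" by simp
      then show ?thesis
        using less.hyps[OF _ run(1)[unfolded Running] less.prems(2)] k1 less.prems(3,4) nc True
        unfolding cr(1) Running by simp
    next
      case (Halted m1 b)
      then show ?thesis using run(1) by (intro exI[of _ 0]) (simp add: funpow_Halted)
    qed
    show ?thesis
    proof (cases "crosses ?N (Running m h) c1 \<and> \<not> crosses ?N (Running m' h') c1'")
      case True
      \<comment> \<open>The second run cannot halt here: the first is about to record a crossing and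
        the sequences are equal.\<close>
      then obtain m1' h1' where "c1' = Running m1' h1'"
        using less.prems(3) unfolding cr by (cases c1') (auto simp: crossings_Halted)
      moreover from this True have "(h' < ?N) = (h1' < ?N)" by simp
      ultimately show ?thesis
        using less.hyps[OF _ less.prems(1) run(2)[unfolded \<open>c1' = Running m1' h1'\<close>]] k1' less.prems(3,4) True \<open>h < ?N\<close>
        unfolding cr(2) by simp
    next
      case False
      then obtain l \<nu> where "(?g ^^ l) c1 = Halted \<nu> d" using ex both by blast
      then have "(?g ^^ Suc l) (Running m h) = Halted \<nu> d" by (simp only: funpow_Suc_right comp_apply g)
      with \<open>h < ?N\<close> show ?thesis by (metis (full_types))
    qed
  next
    case False
    have g: "?g (Running m' h') = c1'"
      unfolding c1'_def using next_config_right[of x h' x' A y' m'] False less.prems(4) x by simp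
    have ex: "\<exists>l \<nu>. (?g ^^ l) c1' = Halted \<nu> d"
      if nc: "\<not> crosses ?N (Running m' h') c1'"
    proof (cases c1')
      case (Running m1 h1)
      with nc False less.prems(4) have "\<not> h1 < ?N" by simp
      then show ?thesis
        using less.hyps[OF _ less.prems(1) run(2)[unfolded Running]] k1' less.prems(3,4) nc False
        unfolding cr(2) Running by simp
    next
      case (Halted m1 b)
      then show ?thesis using run(2) by (intro exI[of _ 0]) (simp add: funpow_Halted)
    qed
    show ?thesis
    proof (cases "crosses ?N (Running m' h') c1' \<and> \<not> crosses ?N (Running m h) c1")
      case True
      then obtain m1 h1 where "c1 = Running m1 h1"
        using less.prems(3) unfolding cr by (cases c1) (auto simp: crossings_Halted)
      moreover from this True have "(h < ?N) = (h1 < ?N)" by simp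
      ultimately show ?thesis
        using less.hyps[OF _ run(1)[unfolded \<open>c1 = Running m1 h1\<close>] less.prems(2)] k1 less.prems(3,4) True \<open>\<not> h < ?N\<close>
        unfolding cr(1) by simp
    next
      case False
      then obtain l \<nu> where "(?g ^^ l) c1' = Halted \<nu> d" using ex both by blast
      then have "(?g ^^ Suc l) (Running m' h') = Halted \<nu> d" by (simp only: funpow_Suc_right comp_apply g)
      with \<open>\<not> h < ?N\<close> show ?thesis by (metis (full_types))
    qed
  qed
qed

section \<open>Number and length of crossing sequences\<close>

text \<open>Amortisation: a step earns 2, a crossing costs \<open>N\<close>, and the potential is
  \<open>2 * h\<close> on the left and \<open>N\<close> on the right. Walking to the boundary earns
  \<open>2 * N\<close>, which pays for entering the right half and for the later rewind.\<close>

lemma length_crossings_time: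
  assumes "N \<le> length w"
  shows "N * length (crossings A w N k (Running m h)) \<le> 2 * k + (if h < N then 2 * h else N)"
proof (induction k arbitrary: m h)
  case (Suc k)
  show ?case
  proof (cases "next_config A w (Running m h)")
    case (Running m' h')
    have "h' \<le> Suc h"
      using Running by (auto split: prod.splits action.splits)
    moreover have "N \<le> h' \<Longrightarrow> h < N \<Longrightarrow> h' = N" "N \<le> h \<Longrightarrow> h' < N \<Longrightarrow> h' = 0"
      using cross_right[OF Running] cross_left[OF Running] assms by auto
    ultimately show ?thesis using Suc[of m' h'] Running
      by (auto simp: algebra_simps split: if_splits)
  next
    case (Halted m' b)
    then show ?thesis by (simp add: crossings_Halted)
  qed
qed simp

text \<open>Without a rewind the head never returns to the left half.\<close>

lemma length_crossings_no_rewind: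
  assumes "N \<le> length w"
    and "\<And>j m' h'. (next_config A w ^^ j) (Running m h) = Running m' h' \<Longrightarrow>
      snd (step A m' (symbol_at w h')) \<noteq> Rewind"
  shows "length (crossings A w N k (Running m h)) \<le> (if h < N then 1 else 0)"
  using assms(2)
proof (induction k arbitrary: m h)
  case (Suc k)
  show ?case
  proof (cases "next_config A w (Running m h)")
    case (Running m' h')
    have "length (crossings A w N k (Running m' h')) \<le> (if h' < N then 1 else 0)"
    proof (rule Suc.IH)
      fix j m'' h'' assume "(next_config A w ^^ j) (Running m' h') = Running m'' h''"
      then have "(next_config A w ^^ Suc j) (Running m h) = Running m'' h''"
        unfolding funpow_Suc_right using Running by simp
      then show "snd (step A m'' (symbol_at w h'')) \<noteq> Rewind" by (rule Suc.prems)
    qed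
    moreover have "h' < N \<Longrightarrow> h < N"
      using cross_left[OF Running] assms(1) Suc.prems[of 0 m h] by (meson funpow_0 leI)
    ultimately show ?thesis using Running by (auto split: if_splits)
  next
    case (Halted m' b)
    then show ?thesis by (simp add: crossings_Halted)
  qed
qed simp

lemma set_crossings:
  "set (crossings A w N k c) \<subseteq> range (\<lambda>j. memory ((next_config A w ^^ j) c))"
proof (induction k arbitrary: c)
  case (Suc k)
  have "range (\<lambda>j. memory ((next_config A w ^^ j) (next_config A w c))) \<subseteq>
    range (\<lambda>j. memory ((next_config A w ^^ j) c))"
    by (metis (no_types, lifting) comp_apply funpow_Suc_right image_subsetI rangeI)
  moreover have "memory (next_config A w c) \<in> range (\<lambda>j. memory ((next_config A w ^^ j) c))"
    using rangeI[of "\<lambda>j. memory ((next_config A w ^^ j) c)" 1] by simp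
  ultimately show ?case using Suc[of "next_config A w c"] by auto
qed simp

text \<open>With empty memory a rewind restores the initial configuration, so the run would loop.
  This settles the case of space 0 in the product bound.\<close>

lemma no_memory_no_rewind:
  assumes halts: "config_after A w k = Halted m b"
    and mem: "\<And>j. memory (config_after A w j) = []"
    and j: "config_after A w j = Running m' h'"
  shows "snd (step A m' (symbol_at w h')) \<noteq> Rewind"
proof
  assume "snd (step A m' (symbol_at w h')) = Rewind"
  then have "config_after A w (Suc j) = Running [] 0"
    using j mem[of "Suc j"] by (auto simp: config_after_def split: prod.splits)
  moreover have "initial A = []" using mem[of 0] by (simp add: config_after_def)
  ultimately have loop: "(next_config A w ^^ Suc j) (Running [] 0) = Running [] 0"
    and k: "(next_config A w ^^ k) (Running [] 0) = Halted m b"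
    using halts by (simp_all add: config_after_def)
  \<comment> \<open>These \<open>k\<close> rounds of the loop last at least \<open>k\<close> steps,
    by which time the run has halted.\<close>
  have "(next_config A w ^^ (k * Suc j)) (Running [] 0) = Running [] 0"
    by (induction k) (simp_all only: mult_Suc mult_0 funpow_add comp_apply loop funpow_0)
  moreover have "k * Suc j = k * j + k" by simp
  ultimately have "(next_config A w ^^ (k * j)) (Halted m b) = Running [] 0"
    using k by (metis comp_apply funpow_add)
  then show False by (simp add: funpow_Halted)
qed

lemma card_lists_of_lists_le:
  "finite {ms :: bool list list. set ms \<subseteq> {m. length m \<le> s} \<and> length ms \<le> q}"
  "card {ms :: bool list list. set ms \<subseteq> {m. length m \<le> s} \<and> length ms \<le> q} \<le> 2 ^ (Suc s * q)"
proof -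
  have eq: "{m :: bool list. length m \<le> s} = {m. set m \<subseteq> UNIV \<and> length m \<le> s}" by simp
  have fin: "finite {m :: bool list. length m \<le> s}" unfolding eq by (rule finite_lists_length_le) simp
  then show "finite {ms :: bool list list. set ms \<subseteq> {m. length m \<le> s} \<and> length ms \<le> q}"
    by (rule finite_lists_length_le)
  define M where "M = card {m :: bool list. length m \<le> s}"
  have "M = (\<Sum>i\<le>s. 2 ^ i)" unfolding M_def eq by (subst card_lists_length_le) auto
  \<comment> \<open>Being one short of a power of two leaves room for the shorter lists: the powers
    of \<open>M\<close> up to \<open>q\<close> sum to at most \<open>Suc M ^ q\<close>.\<close>
  also have "\<dots> = 2 ^ Suc s - 1" by (induction s) auto
  finally have M: "Suc M = 2 ^ Suc s" by simp
  have "card {ms. set ms \<subseteq> {m :: bool list. length m \<le> s} \<and> length ms \<le> q} = (\<Sum>i\<le>q. M ^ i)"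
    unfolding M_def by (rule card_lists_length_le[OF fin])
  also have "\<dots> \<le> Suc M ^ q"
  proof (induction q)
    case (Suc q)
    have "M * M ^ q \<le> M * Suc M ^ q" by (intro mult_le_mono2 power_mono) auto
    from add_mono[OF Suc this] show ?case by simp
  qed simp
  also have "\<dots> = 2 ^ (Suc s * q)" unfolding M by (rule power_mult[symmetric])
  finally show "card {ms :: bool list list. set ms \<subseteq> {m. length m \<le> s} \<and> length ms \<le> q} \<le> 2 ^ (Suc s * q)" .
qed

section \<open>Lower bounds\<close>

text \<open>With \<open>i\<close> in the left part, each half of the marked input depends on one bit
  string only, as \<open>cut_and_paste\<close> requires.\<close>

lemma marked_append:
  "marked (u @ w) i (length u) =
    map (\<lambda>k. (u ! k, k = i, False)) [0..<length u] @
    map (\<lambda>k. (w ! k, length u + k = i, k = 0)) [0..<length w]"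
  by (rule nth_equalityI) (auto simp: marked_def nth_append)

lemma alice_bob_instance:
  assumes "0 < L"
  shows "(alice a L @ bob b, 0, L) \<in> instances {0, 1 :: nat} {..4 :: nat}"
proof -
  have "cell j c \<le> 4" for j c using cell_less[of j c] by simp
  then have "alice a L @ bob b \<in> lists (alphabet {0, 1 :: nat} {..4 :: nat})"
    by (auto simp: alice_def alice_letter_def bob_def bob_blocks_def bob_block_def alphabet_def
        split: if_splits)
  with assms show ?thesis by (simp add: instances_def)
qed

lemma decides_flip_alice_bob:
  assumes "decides_flip {0, 1 :: nat} {..4 :: nat} A" "0 < L"
  shows "\<exists>k m. config_after A (marked (alice a L @ bob b) 0 L) k =
    Halted m (flippable (alice a L @ bob b) (0, 0) (1, 0))"
proof -
  have "event_at (alice a L @ bob b) 0 = (0, 0)" "event_at (alice a L @ bob b) L = (1, 0)"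
    using event_at_alice[of 0 L a "bob b"] event_at_bob[of 0 b a L] assms(2) by simp_all
  moreover have "\<exists>k m. config_after A (marked (alice a L @ bob b) 0 L) k =
      Halted m (flippable (alice a L @ bob b) (event_at (alice a L @ bob b) 0) (event_at (alice a L @ bob b) L))"
    using assms(1) alice_bob_instance[OF assms(2), of a b] unfolding decides_flip_def by blast
  ultimately show ?thesis by simp
qed

text \<open>If \<open>(a, a)\<close> and \<open>(b, b)\<close> had the same crossing sequence, the
  algorithm would also reject the mixed pair \<open>(a, b)\<close>, which is flippable. So
  \<open>2 ^ m\<close> sequences are needed.\<close>

lemma crossings_lower_bound:
  assumes dec: "decides_flip {0, 1 :: nat} {..4 :: nat} A" and space: "uses_space {0, 1 :: nat} {..4 :: nat} A S"
    and m: "0 < m" "m < L"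
    and few: "\<And>a. length a = m \<Longrightarrow> \<exists>k \<mu> d. config_after A (marked (alice a L @ bob a) 0 L) k = Halted \<mu> d \<and>
      length (crossings A (marked (alice a L @ bob a) 0 L) L k (Running (initial A) 0)) \<le> q"
  shows "m \<le> Suc (S (L + (2 * m + 1))) * q"
proof -
  define x where "x a = map (\<lambda>k. (alice a L ! k, k = 0, False)) [0..<L]" for a
  define y where "y b = map (\<lambda>k. (bob b ! k, L + k = 0, k = 0)) [0..<length (bob b)]" for b
  have w: "marked (alice a L @ bob b) 0 L = x a @ y b" for a b
    using marked_append[of "alice a L" "bob b" 0] by (simp add: x_def y_def)
  define V where "V = {a :: bool list. length a = m}"
  have "\<forall>a \<in> V. \<exists>k \<mu> d. config_after A (x a @ y a) k = Halted \<mu> d \<and>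
      length (crossings A (x a @ y a) L k (Running (initial A) 0)) \<le> q"
    using few unfolding w V_def by blast
  then obtain k where k: "\<And>a. a \<in> V \<Longrightarrow> \<exists>\<mu> d. config_after A (x a @ y a) (k a) = Halted \<mu> d \<and>
      length (crossings A (x a @ y a) L (k a) (Running (initial A) 0)) \<le> q"
    by metis
  define f where "f a = crossings A (x a @ y a) L (k a) (Running (initial A) 0)" for a
  have halt: "\<exists>\<mu>. config_after A (x a @ y a) (k a) = Halted \<mu> False" if a: "a \<in> V" for a
  proof -
    have "\<not> flippable (alice a L @ bob a) (0, 0) (1, 0)"
      using a m by (intro not_flippable_same_bits) (auto simp: V_def)
    then obtain k' \<mu>' where "config_after A (x a @ y a) k' = Halted \<mu>' False"
      using decides_flip_alice_bob[OF dec, of L a a] m unfolding w by auto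
    then show ?thesis using k[OF a] halts_unique by metis
  qed
  have "inj_on f V"
  proof (rule inj_onI, rule ccontr)
    fix a b assume ab: "a \<in> V" "b \<in> V" "f a = f b" "a \<noteq> b"
    obtain \<mu> where \<mu>: "config_after A (x a @ y a) (k a) = Halted \<mu> False" using halt[OF ab(1)] by blast
    obtain \<mu>' where \<mu>': "config_after A (x b @ y b) (k b) = Halted \<mu>' False" using halt[OF ab(2)] by blast
    have "\<exists>l \<nu>. (next_config A (x a @ y b) ^^ l)
        (if 0 < length (x a) then Running (initial A) 0 else Running (initial A) 0) = Halted \<nu> False"
      by (rule cut_and_paste[where k = "k a" and k' = "k b" and x' = "x b" and y = "y a"])
        (use ab \<mu> \<mu>' m in \<open>auto simp: config_after_def f_def x_def y_def V_def\<close>)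
    then obtain l \<nu> where l: "config_after A (x a @ y b) l = Halted \<nu> False"
      by (auto simp: config_after_def)
    have "flippable (alice a L @ bob b) (0, 0) (1, 0)"
      using ab m by (intro flippable_different_bits) (auto simp: V_def)
    then obtain k' \<mu>'' where "config_after A (x a @ y b) k' = Halted \<mu>'' True"
      using decides_flip_alice_bob[OF dec, of L a b] m unfolding w by auto
    then show False using halts_unique[OF l] by blast
  qed
  moreover have "f ` V \<subseteq> {ms. set ms \<subseteq> {\<mu>. length \<mu> \<le> S (L + (2 * m + 1))} \<and> length ms \<le> q}"
  proof -
    have "length (memory (config_after A (x a @ y a) j)) \<le> S (L + (2 * m + 1))" if "a \<in> V" for a j
    proof -
      have "(alice a L @ bob a, 0, L) \<in> instances {0, 1} {..4}" using m by (intro alice_bob_instance) simp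
      then have "length (memory (config_after A (x a @ y a) j)) \<le> S (length (alice a L @ bob a))"
        using space unfolding uses_space_def w[symmetric] by blast
      then show ?thesis using that by (simp add: V_def)
    qed
    then have "set (f a) \<subseteq> {\<mu>. length \<mu> \<le> S (L + (2 * m + 1))}" if "a \<in> V" for a
      using set_crossings[of A "x a @ y a" L "k a" "Running (initial A) 0"] that
      unfolding f_def config_after_def by blast
    moreover have "length (f a) \<le> q" if "a \<in> V" for a using k[OF that] by (auto simp: f_def)
    ultimately show ?thesis by blast
  qed
  ultimately have "card V \<le> 2 ^ (Suc (S (L + (2 * m + 1))) * q)"
    using card_lists_of_lists_le[of "S (L + (2 * m + 1))" q]
    by (meson card_inj_on_le order_trans)
  moreover have "card V = 2 ^ m"
    using card_lists_length_eq[of "UNIV :: bool set" m] by (simp add: V_def)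
  ultimately show ?thesis by simp
qed

lemma space_lower_bound_no_rewind:
  assumes dec: "decides_flip {0, 1 :: nat} {..4 :: nat} A" and space: "uses_space {0, 1 :: nat} {..4 :: nat} A S"
    and m: "0 < m" "m < L"
    and no: "\<And>a j \<mu> h. length a = m \<Longrightarrow> config_after A (marked (alice a L @ bob a) 0 L) j = Running \<mu> h \<Longrightarrow>
      snd (step A \<mu> (symbol_at (marked (alice a L @ bob a) 0 L) h)) \<noteq> Rewind"
  shows "m \<le> Suc (S (L + (2 * m + 1)))"
proof -
  have "m \<le> Suc (S (L + (2 * m + 1))) * 1"
  proof (rule crossings_lower_bound[OF dec space m])
    fix a :: "bool list" assume a: "length a = m"
    let ?w = "marked (alice a L @ bob a) 0 L"
    obtain k \<mu> d where "config_after A ?w k = Halted \<mu> d"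
      using decides_flip_alice_bob[OF dec, of L a a] m by auto
    moreover have "length (crossings A ?w L k (Running (initial A) 0)) \<le> (if 0 < L then 1 else 0)"
      by (rule length_crossings_no_rewind) (use no[OF a] in \<open>auto simp: config_after_def marked_def\<close>)
    ultimately show "\<exists>k \<mu> d. config_after A ?w k = Halted \<mu> d \<and>
        length (crossings A ?w L k (Running (initial A) 0)) \<le> 1" using m by auto
  qed
  then show ?thesis by simp
qed

lemma space_time_lower_bound:
  assumes dec: "decides_flip {0, 1 :: nat} {..4 :: nat} A" and space: "uses_space {0, 1 :: nat} {..4 :: nat} A S"
    and time: "uses_time {0, 1 :: nat} {..4 :: nat} A \<tau>" and m: "1 < m" "m < L"
  shows "m * L \<le> 4 * (S (L + (2 * m + 1)) * \<tau> (L + (2 * m + 1)))"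
proof -
  let ?n = "L + (2 * m + 1)"
  have m0: "0 < m" using m by simp
  have inst: "(alice a L @ bob a, 0, L) \<in> instances {0, 1 :: nat} {..4 :: nat}" for a
    using m by (intro alice_bob_instance) simp
  have len: "length (alice a L @ bob a) = ?n" if "length a = m" for a using that by simp
  \<comment> \<open>Needed to replace \<open>Suc (S ?n)\<close> by \<open>2 * S ?n\<close>. With
    space 0 there is no rewind, and the bound without rewinds gives
    \<open>m \<le> 1\<close>.\<close>
  have "S ?n \<noteq> 0"
  proof
    assume S: "S ?n = 0"
    have "m \<le> Suc (S ?n)"
    proof (rule space_lower_bound_no_rewind[OF dec space m0 m(2)])
      fix a :: "bool list" and j \<mu> h
      assume a: "length a = m" and j: "config_after A (marked (alice a L @ bob a) 0 L) j = Running \<mu> h"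
      obtain k \<nu> d where "config_after A (marked (alice a L @ bob a) 0 L) k = Halted \<nu> d"
        using decides_flip_alice_bob[OF dec, of L a a] m by auto
      then show "snd (step A \<mu> (symbol_at (marked (alice a L @ bob a) 0 L) h)) \<noteq> Rewind"
      proof (rule no_memory_no_rewind[OF _ _ j])
        fix i
        have "length (memory (config_after A (marked (alice a L @ bob a) 0 L) i)) \<le> S (length (alice a L @ bob a))"
          using space inst[of a] unfolding uses_space_def by blast
        then show "memory (config_after A (marked (alice a L @ bob a) 0 L) i) = []"
          unfolding len[OF a] S by simp
      qed
    qed
    with S m show False by simp
  qed
  have "m \<le> Suc (S ?n) * (2 * \<tau> ?n div L)"
  proof (rule crossings_lower_bound[OF dec space m0 m(2)])
    fix a :: "bool list" assume a: "length a = m"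
    let ?w = "marked (alice a L @ bob a) 0 L"
    obtain k \<mu> d where k: "k \<le> \<tau> (length (alice a L @ bob a))" "config_after A ?w k = Halted \<mu> d"
      using time inst[of a] unfolding uses_time_def by blast
    have "L * length (crossings A ?w L k (Running (initial A) 0)) \<le> 2 * k + (if 0 < L then 2 * 0 else L)"
      by (rule length_crossings_time) (simp add: marked_def)
    also have "\<dots> \<le> 2 * \<tau> ?n" using k(1) m unfolding len[OF a] by simp
    finally have "length (crossings A ?w L k (Running (initial A) 0)) \<le> 2 * \<tau> ?n div L"
      using m by (simp add: less_eq_div_iff_mult_less_eq mult.commute)
    with k(2) show "\<exists>k \<mu> d. config_after A ?w k = Halted \<mu> d \<and>
        length (crossings A ?w L k (Running (initial A) 0)) \<le> 2 * \<tau> ?n div L" by blast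
  qed
  then have "m * L \<le> Suc (S ?n) * (2 * \<tau> ?n div L) * L" by (rule mult_le_mono1)
  also have "\<dots> \<le> Suc (S ?n) * (2 * \<tau> ?n)"
    unfolding mult.assoc by (intro mult_le_mono2) (simp add: div_times_less_eq_dividend)
  also have "\<dots> \<le> (2 * S ?n) * (2 * \<tau> ?n)" using \<open>S ?n \<noteq> 0\<close> by (intro mult_le_mono1) simp
  finally show ?thesis by simp
qed

section \<open>Choice of parameters and asymptotics\<close>

lemma split_length:
  fixes n :: nat
  assumes "16 \<le> n"
  obtains m L where "n = L + (2 * m + 1)" "1 < m" "m < L" "n \<le> 4 * m"
proof -
  \<comment> \<open>With \<open>L = m + 1\<close> an instance has \<open>3 * m + 2\<close> letters;
    the surplus of \<open>n\<close> goes into padding writes. From \<open>3 * m \<ge> n - 4\<close>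
    the bound \<open>n \<le> 4 * m\<close> follows once \<open>n \<ge> 16\<close>.\<close>
  define m where "m = (n - 2) div 3"
  have "3 * m \<le> n - 2" "n - 2 \<le> 3 * m + 2" unfolding m_def by presburger+
  with assms have "n = (n - (2 * m + 1)) + (2 * m + 1)" "1 < m" "m < n - (2 * m + 1)" "n \<le> 4 * m"
    by linarith+
  then show thesis by (rule that)
qed

theorem theorem3p4:
  "\<exists>(T :: nat set) (X :: nat set). finite T \<and> finite X \<and>
    (\<forall>A S. decides_flip T X A \<and> one_pass T X A \<and> uses_space T X A S \<longrightarrow>
      (\<lambda>n. real (S n)) \<in> \<Omega>(\<lambda>n. real n)) \<and>
    (\<forall>A S \<tau>. decides_flip T X A \<and> uses_space T X A S \<and> uses_time T X A \<tau> \<longrightarrow>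
      (\<lambda>n. real (S n) * real (\<tau> n)) \<in> \<Omega>(\<lambda>n. real n ^ 2))"
proof (rule exI[of _ "{0, 1}"], rule exI[of _ "{..4}"], intro conjI allI impI)
  fix A S
  assume "decides_flip {0, 1 :: nat} {..4 :: nat} A \<and> one_pass {0, 1 :: nat} {..4 :: nat} A \<and> uses_space {0, 1 :: nat} {..4 :: nat} A S"
  then have dec: "decides_flip {0, 1 :: nat} {..4 :: nat} A" and one: "one_pass {0, 1 :: nat} {..4 :: nat} A"
    and space: "uses_space {0, 1 :: nat} {..4 :: nat} A S" by simp_all
  \<comment> \<open>From \<open>n \<le> 4 * m \<le> 4 * S n + 4\<close> and
    \<open>n \<ge> 16\<close> the additive 4 is absorbed by doubling.\<close>
  have "n \<le> 8 * S n" if n: "16 \<le> n" for n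
  proof -
    obtain m L where m: "n = L + (2 * m + 1)" "1 < m" "m < L" "n \<le> 4 * m" using split_length[OF n] .
    have "m \<le> Suc (S (L + (2 * m + 1)))"
    proof (rule space_lower_bound_no_rewind[OF dec space])
      show "snd (step A \<mu> (symbol_at (marked (alice a L @ bob a) 0 L) h)) \<noteq> Rewind"
        if "config_after A (marked (alice a L @ bob a) 0 L) j = Running \<mu> h" for a j \<mu> h
      proof -
        have "0 < L" using m by simp
        with one that alice_bob_instance[of L a a] show ?thesis unfolding one_pass_def by blast
      qed
    qed (use m in auto)
    with m n show ?thesis by simp
  qed
  then have "\<forall>\<^sub>F n in at_top. norm (real n) \<le> 8 * norm (real (S n))"
    by (intro eventually_at_top_linorderI[of 16]) (simp, metis of_nat_le_iff of_nat_mult of_nat_numeral)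
  then show "(\<lambda>n. real (S n)) \<in> \<Omega>(\<lambda>n. real n)"
    unfolding bigomega_iff_bigo by (rule landau_o.bigI[rotated]) simp
next
  fix A S \<tau>
  assume "decides_flip {0, 1 :: nat} {..4 :: nat} A \<and> uses_space {0, 1 :: nat} {..4 :: nat} A S \<and> uses_time {0, 1 :: nat} {..4 :: nat} A \<tau>"
  then have dec: "decides_flip {0, 1 :: nat} {..4 :: nat} A"
    and space: "uses_space {0, 1 :: nat} {..4 :: nat} A S" and time: "uses_time {0, 1 :: nat} {..4 :: nat} A \<tau>" by simp_all
  \<comment> \<open>The constant is 4 from \<open>n \<le> 4 * m\<close>, 4 from
    \<open>n \<le> 4 * L\<close> and 4 from \<open>space_time_lower_bound\<close>.\<close>
  have "n ^ 2 \<le> 64 * (S n * \<tau> n)" if n: "16 \<le> n" for n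
  proof -
    obtain m L where m: "n = L + (2 * m + 1)" "1 < m" "m < L" "n \<le> 4 * m" using split_length[OF n] .
    have "n * n \<le> (4 * m) * (4 * L)" using m by (intro mult_le_mono) auto
    also have "\<dots> = 16 * (m * L)" by simp
    also have "\<dots> \<le> 16 * (4 * (S n * \<tau> n))"
      using space_time_lower_bound[OF dec space time m(2,3)]
      unfolding m(1)[symmetric] by (rule mult_le_mono2)
    finally show ?thesis by (simp add: power2_eq_square)
  qed
  then have "norm (real n ^ 2) \<le> 64 * norm (real (S n) * real (\<tau> n))" if "16 \<le> n" for n
    using that of_nat_mono[of "n ^ 2" "64 * (S n * \<tau> n)", where ?'a = real] by simp
  then have "\<forall>\<^sub>F n in at_top. norm (real n ^ 2) \<le> 64 * norm (real (S n) * real (\<tau> n))"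
    by (intro eventually_at_top_linorderI[of 16])
  then show "(\<lambda>n. real (S n) * real (\<tau> n)) \<in> \<Omega>(\<lambda>n. real n ^ 2)"
    unfolding bigomega_iff_bigo by (rule landau_o.bigI[rotated]) simp
qed simp_all

end
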